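(* Let $d\ge1$ and $1\le j\le d$. (1) For every $1<p\le\infty$ there is a constant $C_p$ such that for all $f\in\ell^{p,1}(\mathbb{Z}^d)$, $$\|\partial_jf\|_{\ell^{p,1}(\mathbb{Z}^d)}\le C_p\,\|f\|_{\ell^{p,1}(\mathbb{Z}^d)}.$$ (2) For $p=1$ the $\ell^{1,1}$-boundedness fails, i.e. there is no constant $C$ with $\|\partial_jf\|_{\ell^{1,1}(\mathbb{Z}^d)}\le C\|f\|_{\ell^{1,1}(\mathbb{Z}^d)}$ for all $f\in\ell^{1,1}(\mathbb{Z}^d)$; but the weak $\ell^{1,1}$-boundedness holds: there is a constant $C$ such that for all $f\in\ell^{1,1}(\mathbb{Z}^d)$, $$\sup_{\alpha>0}\ \alpha\,\left|\left\{k\in\mathbb{Z}^d:\ |\partial_jf(k)|\ge\frac{\alpha}{\langle k\rangle}\right\}\right|\le C\,\|f\|_{\ell^{1,1}(\mathbb{Z}^d)},$$ where $|\cdot|$ of a set denotes its cardinality.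
   Context: For $m\in\mathbb{Z}^d$, $\langle m\rangle=(1+|m|^2)^{1/2}$ with $|m|$ the Euclidean norm. $\ell^{p,\alpha}(\mathbb{Z}^d)$ is the space of $f:\mathbb{Z}^d\to\mathbb{C}$ with $\|f\|_{\ell^{p,\alpha}}=\|f_\alpha\|_{\ell^p(\mathbb{Z}^d)}<\infty$, where $f_\alpha(m)=f(m)\langle m\rangle^\alpha$. Discrete partial derivative: $\partial_ju=u*\varphi_j$ (convolution on $\mathbb{Z}^d$), where $\varphi_j(ae_j)=\frac{-4i}{\pi(4a^2-1)}$ for $a\in\mathbb{Z}$ and $\varphi_j=0$ off the axis $\mathbb{Z}e_j$; $e_j$ is the $j$-th standard basis vector. *)

theory Defs
  imports "HOL-Analysis.Analysis"
begin

definition bracket :: "int ^ 'd \<Rightarrow> real" where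
  "bracket m = sqrt (1 + (norm ((\<chi> i. of_int (m $ i)) :: real ^ 'd))\<^sup>2)"

text \<open>Norms take the value \<open>\<infinity>\<close> off the space, and the exponent ranges over
  \<open>ennreal\<close> so that \<open>p = \<infinity>\<close> (the supremum norm) is included. Only \<open>p \<ge> 1\<close> is
  meaningful. There is no power function on \<open>ennreal\<close>, which forces the case split
  on the value of the sum.\<close>

definition lp_norm :: "ennreal \<Rightarrow> ('a \<Rightarrow> complex) \<Rightarrow> ennreal" where
  "lp_norm p f =
     (if p = \<infinity> then (SUP m. ennreal (norm (f m)))
      else let S = (\<Sum>\<^sub>\<infinity>m. ennreal (norm (f m) powr enn2real p))
           in if S = \<infinity> then \<infinity> else ennreal (enn2real S powr (1 / enn2real p)))"

definition weighted_lp_norm :: "ennreal \<Rightarrow> real \<Rightarrow> (int ^ 'd \<Rightarrow> complex) \<Rightarrow> ennreal" where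
  "weighted_lp_norm p \<alpha> f = lp_norm p (\<lambda>m. f m * of_real (bracket m powr \<alpha>))"

definition weighted_lp :: "ennreal \<Rightarrow> real \<Rightarrow> (int ^ 'd \<Rightarrow> complex) set" where
  "weighted_lp p \<alpha> = {f. weighted_lp_norm p \<alpha> f < \<infinity>}"

definition lattice_convolution ::
    "(int ^ 'd \<Rightarrow> complex) \<Rightarrow> (int ^ 'd \<Rightarrow> complex) \<Rightarrow> int ^ 'd \<Rightarrow> complex" where
  "lattice_convolution u v k = (\<Sum>\<^sub>\<infinity>m. u m * v (k - m))"

text \<open>The multiples \<open>a e\<^sub>j\<close> are the vectors \<open>axis j a\<close>, and \<open>m\<close> is one of them iff
  \<open>m = axis j (m $ j)\<close>.\<close>

definition deriv_kernel :: "'d \<Rightarrow> int ^ 'd \<Rightarrow> complex" where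
  "deriv_kernel j m =
     (if m = axis j (m $ j)
      then - 4 * \<i> / (of_real pi * (4 * (of_int (m $ j))\<^sup>2 - 1)) else 0)"

definition discrete_partial :: "'d \<Rightarrow> (int ^ 'd \<Rightarrow> complex) \<Rightarrow> int ^ 'd \<Rightarrow> complex" where
  "discrete_partial j u = lattice_convolution u (deriv_kernel j)"

lemma deriv_kernel_axis:
  "deriv_kernel j (axis j a) = - 4 * \<i> / (of_real pi * (4 * (of_int a)\<^sup>2 - 1))"
  by (simp add: deriv_kernel_def)

lemma deriv_kernel_off_axis:
  "m \<notin> range (axis j) \<Longrightarrow> deriv_kernel j m = 0"
  by (auto simp: deriv_kernel_def)

text \<open>The infinite sum operator returns 0 for a family that is not summable. The rest
  of this theory shows that this does not happen here: the series defining
  \<open>discrete_partial j f k\<close> converges absolutely for \<open>f\<close> in a weighted space with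
  \<open>p \<ge> 1\<close> and \<open>\<alpha> \<ge> 0\<close>.\<close>

lemma bracket_ge_1: "bracket m \<ge> 1"
  by (simp add: bracket_def)

lemma lp_norm_finite_imp_bounded:
  assumes "lp_norm p f < \<infinity>" "p \<ge> 1"
  obtains M where "\<And>m. norm (f m) \<le> M"
proof (cases "p = \<infinity>")
  case True
  define M where "M = enn2real (SUP m. ennreal (norm (f m)))"
  have fin: "(SUP m. ennreal (norm (f m))) < \<infinity>"
    using assms True by (simp add: lp_norm_def)
  have "norm (f m) \<le> M" for m
  proof -
    have "ennreal (norm (f m)) \<le> (SUP m. ennreal (norm (f m)))"
      by (rule SUP_upper) simp
    also have "\<dots> = ennreal M"
      using fin by (simp add: M_def)
    finally show ?thesis
      by (simp add: M_def)
  qed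
  thus ?thesis by (rule that)
next
  case False
  define q where "q = enn2real p"
  have q: "q \<ge> 1"
    using assms(2) False enn2real_mono[of 1 p]
    by (simp add: q_def less_top)
  define S where "S = (\<Sum>\<^sub>\<infinity>m. ennreal (norm (f m) powr q))"
  have fin: "S \<noteq> \<infinity>"
    using assms(1) False by (auto simp: lp_norm_def S_def q_def Let_def)
  have "norm (f m) \<le> 1 + enn2real S" for m
  proof (cases "norm (f m) \<le> 1")
    case True
    thus ?thesis by (smt (verit) enn2real_nonneg)
  next
    case False
    have "ennreal (norm (f m) powr q) = (\<Sum>\<^sub>\<infinity>m\<in>{m}. ennreal (norm (f m) powr q))"
      by simp
    also have "\<dots> \<le> S"
      unfolding S_def by (rule infsum_mono_neutral) (auto intro: nonneg_summable_on_complete)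
    finally have "norm (f m) powr q \<le> enn2real S"
      using fin enn2real_mono[of "ennreal (norm (f m) powr q)" S] by (simp add: less_top)
    moreover have "norm (f m) powr 1 \<le> norm (f m) powr q"
      using False q by (intro powr_mono) auto
    ultimately show ?thesis using False by simp
  qed
  thus ?thesis by (rule that)
qed

lemma weighted_lp_imp_bounded:
  assumes "f \<in> weighted_lp p \<alpha>" "p \<ge> 1" "\<alpha> \<ge> 0"
  obtains M where "\<And>m. norm (f m) \<le> M"
proof -
  obtain M where M: "\<And>m. norm (f m * of_real (bracket m powr \<alpha>)) \<le> M"
    using assms lp_norm_finite_imp_bounded
    unfolding weighted_lp_def weighted_lp_norm_def by blast
  have "norm (f m) \<le> M" for m
  proof -
    have "bracket m powr \<alpha> \<ge> 1"
      using bracket_ge_1 assms(3) by (rule ge_one_powr_ge_zero)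
    hence "norm (f m) * 1 \<le> norm (f m) * (bracket m powr \<alpha>)"
      by (intro mult_left_mono) auto
    thus ?thesis using M[of m] by (simp add: norm_mult)
  qed
  thus ?thesis by (rule that)
qed

lemma abs_summable_deriv_kernel: "(\<lambda>m. norm (deriv_kernel j m)) summable_on UNIV"
proof -
  let ?g = "\<lambda>a::int. norm (deriv_kernel j (axis j a))"
  have bound: "?g a \<le> 2 * (1 / (1 + real (nat \<bar>a\<bar>)) ^ 2) * 4" for a
  proof -
    have "?g a = 4 / (pi * \<bar>4 * (real_of_int a)\<^sup>2 - 1\<bar>)"
    proof -
      have "(4 * (of_int a)\<^sup>2 - 1 :: complex) = of_real (4 * (real_of_int a)\<^sup>2 - 1)"
        by simp
      thus ?thesis
        by (simp only: deriv_kernel_axis norm_divide norm_mult norm_of_real) simp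
    qed
    also have "\<dots> \<le> 4 / (1 * (((1 + real_of_int \<bar>a\<bar>) ^ 2) / 2))"
    proof -
      have "(1 + real_of_int \<bar>a\<bar>) ^ 2 / 2 \<le> \<bar>4 * (real_of_int a)\<^sup>2 - 1\<bar>"
      proof (cases "a = 0")
        case False
        define x where "x = real_of_int \<bar>a\<bar>"
        have "x \<ge> 1" using False unfolding x_def by linarith
        moreover have "(real_of_int a)\<^sup>2 = x * x" by (simp add: x_def power2_eq_square)
        moreover have "(1 + x) ^ 2 = 1 + 2 * x + x * x" by (simp add: power2_eq_square algebra_simps)
        moreover have "x * x \<ge> x * 1" using \<open>x \<ge> 1\<close> by (intro mult_left_mono) auto
        ultimately have "(1 + x) ^ 2 / 2 \<le> 4 * (real_of_int a)\<^sup>2 - 1"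
          by linarith
        thus ?thesis unfolding x_def by linarith
      qed auto
      moreover have "0 < (1 + real_of_int \<bar>a\<bar>) ^ 2 / 2"
        by (intro divide_pos_pos zero_less_power) linarith+
      moreover have "1 \<le> pi"
        using pi_ge_two by linarith
      ultimately show ?thesis
        by (intro frac_le mult_mono) linarith+
    qed
    also have "\<dots> = 2 * (1 / (1 + real (nat \<bar>a\<bar>)) ^ 2) * 4"
      by (simp add: of_nat_nat)
    finally show ?thesis .
  qed
  have "summable (\<lambda>n::nat. 1 / (1 + real n) ^ 2)"
    using summable_Suc_iff[of "\<lambda>n. inverse (real n ^ 2)"]
      inverse_power_summable[of 2, where 'a = real]
    by (simp add: inverse_eq_divide)
  hence "summable (\<lambda>n::nat. 2 * (1 / (1 + real n) ^ 2) * 4)"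
    by (intro summable_mult summable_mult2)
  hence nat: "(\<lambda>n::nat. 2 * (1 / (1 + real n) ^ 2) * 4) summable_on UNIV"
    by (intro norm_summable_imp_summable_on) simp
  have pos: "?g summable_on range int"
  proof (subst summable_on_reindex)
    show "(?g \<circ> int) summable_on UNIV"
    proof (rule summable_on_comparison_test[OF nat])
      show "(?g \<circ> int) n \<le> 2 * (1 / (1 + real n) ^ 2) * 4" for n
        using bound[of "int n"] by (simp only: o_def abs_of_nat nat_int)
    qed simp
  qed simp
  have neg: "?g summable_on range (\<lambda>n. - int n)"
  proof (subst summable_on_reindex)
    show "(?g \<circ> (\<lambda>n. - int n)) summable_on UNIV"
    proof (rule summable_on_comparison_test[OF nat])
      show "(?g \<circ> (\<lambda>n. - int n)) n \<le> 2 * (1 / (1 + real n) ^ 2) * 4" for n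
        using bound[of "- int n"] by (simp only: o_def abs_minus_cancel abs_of_nat nat_int)
    qed simp
  qed (auto simp: inj_on_def)
  have "range int \<union> range (\<lambda>n. - int n) = UNIV"
  proof (intro set_eqI iffI UNIV_I)
    fix a :: int
    show "a \<in> range int \<union> range (\<lambda>n. - int n)" by (cases a rule: int_cases2) auto
  qed
  hence "?g summable_on UNIV"
    using summable_on_union[OF pos neg] by simp
  hence "(\<lambda>m. norm (deriv_kernel j m)) summable_on range (axis j)"
    by (subst summable_on_reindex) (auto simp: inj_on_def axis_eq_axis o_def)
  moreover have "(\<lambda>m. norm (deriv_kernel j m)) summable_on range (axis j) \<longleftrightarrow>
      (\<lambda>m. norm (deriv_kernel j m)) summable_on UNIV"
    by (rule summable_on_cong_neutral) (auto simp: deriv_kernel_off_axis)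
  ultimately show ?thesis by blast
qed

lemma abs_summable_discrete_partial:
  assumes "f \<in> weighted_lp p \<alpha>" "p \<ge> 1" "\<alpha> \<ge> 0"
  shows "(\<lambda>m. norm (f m * deriv_kernel j (k - m))) summable_on UNIV"
proof -
  obtain M where M: "\<And>m. norm (f m) \<le> M"
    using weighted_lp_imp_bounded[OF assms] by blast
  have "bij_betw (\<lambda>m. k - m) UNIV UNIV"
    by (rule bij_betwI[where g = "\<lambda>m. k - m"]) auto
  hence "(\<lambda>m. norm (deriv_kernel j (k - m))) summable_on UNIV"
    using summable_on_reindex_bij_betw[of "\<lambda>m. k - m" UNIV UNIV
        "\<lambda>m. norm (deriv_kernel j m)"] abs_summable_deriv_kernel by blast
  hence "(\<lambda>m. M * norm (deriv_kernel j (k - m))) summable_on UNIV"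
    by (rule summable_on_cmult_right)
  thus ?thesis
    by (rule summable_on_comparison_test) (auto simp: norm_mult intro!: mult_right_mono M)
qed

end

theory Submission
  imports Defs
begin

text \<open>On a line \<open>m + \<int>e\<^sub>j\<close> the weight satisfies \<open>\<langle>k\<rangle> \<le> \<langle>n\<rangle> + |k\<^sub>j - n\<^sub>j|\<close> and
  \<open>\<langle>n\<rangle> \<ge> (1 + |n\<^sub>j|) / 2\<close>. With \<open>\<kappa>(a) = 1 / (1 + |a|)\<close>, the weighted operator is therefore
  dominated by the one-dimensional kernel \<open>\<kappa>(x - y)\<^sup>2 + \<kappa>(x - y) \<kappa>(y)\<close>, uniformly in the line.
  The first term is a convolution with a summable function. For the second,
  \<open>\<kappa>(x - y) \<kappa>(y) \<le> \<kappa>(x) (\<kappa>(x - y) + \<kappa>(y))\<close>, so by Hoelder's inequality it maps \<open>g\<close> to a function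
  bounded by a multiple of \<open>\<parallel>g\<parallel>\<^sub>p \<kappa>(x)\<close>. Now \<open>\<kappa>\<close> is in \<open>\<ell>\<^sup>p\<close> for \<open>p > 1\<close>, but only in weak \<open>\<ell>\<^sup>1\<close>
  for \<open>p = 1\<close>. The unit mass at the origin shows that nothing better is true: its image is the
  kernel, whose weighted \<open>\<ell>\<^sup>1\<close> norm is a harmonic series.\<close>

subsection \<open>Sums as integrals over the counting measure\<close>

text \<open>Both sides are suprema of finite partial sums. If the sum is finite, so is every term,
  and the real-valued theory of absolutely summable families applies; otherwise the upper bound is
  trivial. With this, Tonelli's theorem, Markov's inequality and changes of variables can be used on
  the sums in \<open>lp_norm\<close>.\<close>

lemma infsum_ennreal_eq_nn_integral:
  fixes f :: "'a \<Rightarrow> ennreal"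
  shows "infsum f UNIV = (\<integral>\<^sup>+x. f x \<partial>count_space UNIV)"
proof (rule antisym)
  have "sum f F \<le> (\<integral>\<^sup>+x. f x \<partial>count_space UNIV)" if "finite F" for F
  proof -
    have "sum f F = (\<integral>\<^sup>+x. f x * indicator F x \<partial>count_space UNIV)"
      using that by (simp add: nn_integral_indicator_finite)
    also have "\<dots> \<le> (\<integral>\<^sup>+x. f x \<partial>count_space UNIV)"
      by (intro nn_integral_mono) (auto split: split_indicator)
    finally show ?thesis .
  qed
  thus "infsum f UNIV \<le> (\<integral>\<^sup>+x. f x \<partial>count_space UNIV)"
    by (subst nonneg_infsum_complete) (auto intro!: SUP_least)
next
  show "(\<integral>\<^sup>+x. f x \<partial>count_space UNIV) \<le> infsum f UNIV"
  proof (cases "infsum f UNIV = \<infinity>")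
    case False
    have le: "sum f F \<le> infsum f UNIV" if "finite F" for F
      using that by (subst nonneg_infsum_complete) (auto intro!: SUP_upper)
    have "f x < \<infinity>" for x
      using le[of "{x}"] False by (simp add: top.not_eq_extremum)
    define g where "g x = enn2real (f x)" for x
    have f: "f x = ennreal (g x)" for x
      using \<open>f x < \<infinity>\<close> by (simp add: g_def)
    have g0: "g x \<ge> 0" for x by (simp add: g_def)
    have "sum g F \<le> enn2real (infsum f UNIV)" if "finite F" for F
    proof -
      have "ennreal (sum g F) \<le> infsum f UNIV"
        using le[OF that] by (simp add: f g0 sum_ennreal)
      thus ?thesis
        using False enn2real_mono[of "ennreal (sum g F)" "infsum f UNIV"] 
        by (simp add: g0 sum_nonneg top.not_eq_extremum)
    qed
    hence s: "g summable_on UNIV"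
      by (intro nonneg_bdd_above_summable_on) (auto simp: g0 bdd_above_def)
    \<comment> \<open>\<open>infsetsum\<close> is by definition a Lebesgue integral over the
      counting measure, so it links \<open>infsum\<close> to the integral.\<close>
    have a: "Infinite_Set_Sum.abs_summable_on g UNIV"
      using s summable_on_iff_abs_summable_on_real abs_summable_equivalent by blast
    have "(\<integral>\<^sup>+x. f x \<partial>count_space UNIV) = ennreal (infsum g UNIV)"
      using nn_integral_conv_infsetsum[OF a g0] infsetsum_infsum[OF a] by (simp add: f)
    also have "\<dots> = infsum f UNIV"
      by (subst infsum_nonneg_is_SUPREMUM_ennreal[OF s g0], subst nonneg_infsum_complete)
         (auto simp: f g0 sum_ennreal)
    finally show ?thesis by simp
  qed simp
qed

lemma infsum_real_eq_nn_integral: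
  fixes g :: "'a \<Rightarrow> real"
  assumes "g summable_on UNIV" "\<And>x. g x \<ge> 0"
  shows "ennreal (infsum g UNIV) = (\<integral>\<^sup>+x. ennreal (g x) \<partial>count_space UNIV)"
  by (subst infsum_ennreal_eq_nn_integral[symmetric],
      subst infsum_nonneg_is_SUPREMUM_ennreal[OF assms], subst nonneg_infsum_complete)
     (auto simp: assms(2) sum_ennreal)

text \<open>Tonelli's theorem without any countability condition: both iterated integrals equal the
  one over all pairs.\<close>

lemma nn_integral_count_space_swap:
  "(\<integral>\<^sup>+x. (\<integral>\<^sup>+y. f x y \<partial>count_space UNIV) \<partial>count_space UNIV) =
   (\<integral>\<^sup>+y. (\<integral>\<^sup>+x. f x y \<partial>count_space UNIV) \<partial>count_space UNIV)"
  using nn_integral_fst_count_space[of "\<lambda>(x, y). f x y"]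
    nn_integral_snd_count_space[of "\<lambda>(x, y). f x y"] by simp

lemma nn_integral_count_space_diff:
  fixes f :: "'a::ab_group_add \<Rightarrow> ennreal"
  shows "(\<integral>\<^sup>+y. f (x - y) \<partial>count_space UNIV) = (\<integral>\<^sup>+y. f y \<partial>count_space UNIV)"
    and "(\<integral>\<^sup>+y. f (y - x) \<partial>count_space UNIV) = (\<integral>\<^sup>+y. f y \<partial>count_space UNIV)"
proof -
  have "bij_betw (\<lambda>y. x - y) UNIV UNIV"
    by (rule bij_betwI[where g = "\<lambda>y. x - y"]) auto
  thus "(\<integral>\<^sup>+y. f (x - y) \<partial>count_space UNIV) = (\<integral>\<^sup>+y. f y \<partial>count_space UNIV)"
    by (rule nn_integral_bij_count_space)
  have "bij_betw (\<lambda>y. y - x) UNIV UNIV"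
    by (rule bij_betwI[where g = "\<lambda>y. y + x"]) auto
  thus "(\<integral>\<^sup>+y. f (y - x) \<partial>count_space UNIV) = (\<integral>\<^sup>+y. f y \<partial>count_space UNIV)"
    by (rule nn_integral_bij_count_space)
qed

lemma nn_integral_count_space_inj:
  assumes "inj h"
  shows "(\<integral>\<^sup>+x. f (h x) \<partial>count_space UNIV) = (\<integral>\<^sup>+z\<in>range h. f z \<partial>count_space UNIV)"
  using nn_integral_bij_count_space[OF inj_on_imp_bij_betw[OF assms], of f]
  by (simp add: nn_integral_count_space_indicator)

section \<open>Young's and Hoelder's inequalities with non-sharp constants\<close>

text \<open>Young's inequality without the factors \<open>1 / q\<close> and \<open>1 / p\<close>.
  The two powers agree on the curve \<open>t = s powr (q - 1)\<close>; on either side of it the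
  larger power alone dominates the product.\<close>

lemma mult_le_powr_add_powr:
  fixes s t p q :: real
  assumes "1 < p" "1 / p + 1 / q = 1" "0 \<le> s" "0 \<le> t"
  shows "s * t \<le> s powr q + t powr p"
proof -
  have q: "q > 1" using assms(1,2) by (smt (verit) divide_less_eq_1_pos divide_pos_pos divide_nonneg_neg divide_nonpos_nonneg zero_less_divide_1_iff)
  \<comment> \<open>The maps \<open>s powr (q - 1)\<close> and \<open>t powr (p - 1)\<close> are
    thus mutually inverse, so the second case below amounts to
    \<open>s \<le> t powr (p - 1)\<close>.\<close>
  have pq: "(q - 1) * (p - 1) = 1"
    using assms(1,2) q by (simp add: field_simps)
  show ?thesis
  proof (cases "t \<le> s powr (q - 1)")
    case True
    have "s * t \<le> s * s powr (q - 1)" using True assms by (intro mult_left_mono) auto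
    also have "\<dots> = s powr q" using assms(3) by (cases "s = 0") (auto simp: powr_diff)
    finally show ?thesis using powr_ge_zero[of t p] by linarith
  next
    case False
    hence t: "t > 0" using powr_ge_zero[of s "q-1"] by linarith
    have "s = (s powr (q - 1)) powr (p - 1)"
      using assms(3) by (simp add: powr_powr pq)
    also have "\<dots> \<le> t powr (p - 1)" using False assms(1) by (intro powr_mono2) auto
    finally have "s * t \<le> t powr (p - 1) * t" using t by (intro mult_right_mono) auto
    also have "\<dots> = t powr p" using t by (auto simp: powr_diff)
    finally show ?thesis using powr_ge_zero[of s q] by linarith
  qed
qed

text \<open>The constant \<open>A + 1\<close> instead of the sharp \<open>A powr (1 / q)\<close> comes from applying the
  previous inequality to \<open>g / N\<close>.\<close>

lemma nn_integral_count_space_Holder: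
  fixes h g :: "'a \<Rightarrow> real" and u :: "'a \<Rightarrow> ennreal"
  assumes pq: "1 < p" "1 / p + 1 / q = 1" and h0: "\<And>y. 0 \<le> h y" and g0: "\<And>y. 0 \<le> g y"
    and h: "(\<integral>\<^sup>+y. u y * ennreal (h y powr q) \<partial>count_space UNIV) \<le> ennreal A"
    and g: "(\<integral>\<^sup>+y. u y * ennreal (g y powr p) \<partial>count_space UNIV) \<le> ennreal (N powr p)"
    and A: "0 \<le> A" and N: "0 \<le> N"
  shows "(\<integral>\<^sup>+y. u y * ennreal (h y * g y) \<partial>count_space UNIV) \<le> ennreal (N * (A + 1))"
proof -
  \<comment> \<open>Taking \<open>L\<close> strictly above \<open>N\<close> permits division by
    \<open>L\<close> even when \<open>N = 0\<close>. At the end \<open>L = N + e / (A + 1)\<close>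
    costs exactly \<open>e\<close>.\<close>
  have pos: "(\<integral>\<^sup>+y. u y * ennreal (h y * g y) \<partial>count_space UNIV) \<le> ennreal (L * (A + 1))"
    if "N < L" for L
  proof -
    have L: "L > 0" using that N by simp
    have "(\<integral>\<^sup>+y. u y * ennreal (h y * g y) \<partial>count_space UNIV)
      \<le> (\<integral>\<^sup>+y. ennreal L * (u y * ennreal (h y powr q))
            + ennreal (L / L powr p) * (u y * ennreal (g y powr p)) \<partial>count_space UNIV)"
    proof (rule nn_integral_mono)
      fix y
      have "h y * (g y / L) \<le> h y powr q + (g y / L) powr p"
        using L by (intro mult_le_powr_add_powr[OF pq]) (auto simp: h0 g0)
      hence "h y * g y \<le> L * (h y powr q + (g y / L) powr p)"
        using L by (simp add: field_simps)
      also have "\<dots> = L * h y powr q + (L / L powr p) * g y powr p"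
        using L by (simp add: powr_divide g0 algebra_simps)
      finally have "ennreal (h y * g y) \<le> ennreal L * ennreal (h y powr q) + ennreal (L / L powr p) * ennreal (g y powr p)"
        using L by (simp add: ennreal_mult[symmetric] ennreal_plus[symmetric] ennreal_leI del: ennreal_plus)
      hence "u y * ennreal (h y * g y) \<le> u y * (ennreal L * ennreal (h y powr q) + ennreal (L / L powr p) * ennreal (g y powr p))"
        by (rule mult_left_mono) simp
      thus "u y * ennreal (h y * g y) \<le> ennreal L * (u y * ennreal (h y powr q))
            + ennreal (L / L powr p) * (u y * ennreal (g y powr p))"
        by (simp add: algebra_simps)
    qed
    also have "\<dots> = ennreal L * (\<integral>\<^sup>+y. u y * ennreal (h y powr q) \<partial>count_space UNIV)
        + ennreal (L / L powr p) * (\<integral>\<^sup>+y. u y * ennreal (g y powr p) \<partial>count_space UNIV)"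
      by (simp add: nn_integral_add nn_integral_cmult)
    also have "\<dots> \<le> ennreal L * ennreal A + ennreal (L / L powr p) * ennreal (L powr p)"
    proof -
      have "ennreal (N powr p) \<le> ennreal (L powr p)"
        using that N pq by (intro ennreal_leI powr_mono2) auto
      thus ?thesis by (intro add_mono mult_left_mono h order_trans[OF g]) auto
    qed
    also have "\<dots> = ennreal (L * (A + 1))"
      using L A by (simp add: ennreal_mult[symmetric] ennreal_plus[symmetric] algebra_simps del: ennreal_plus)
    finally show ?thesis .
  qed
  show ?thesis
  proof (rule ennreal_le_epsilon)
    fix e :: real assume e: "0 < e"
    have "(\<integral>\<^sup>+y. u y * ennreal (h y * g y) \<partial>count_space UNIV) \<le> ennreal ((N + e / (A + 1)) * (A + 1))"
      using e A by (intro pos) auto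
    also have "(N + e / (A + 1)) * (A + 1) = N * (A + 1) + e"
      using A by (simp add: field_simps)
    also have "ennreal \<dots> = ennreal (N * (A + 1)) + ennreal e"
      using e A N by (simp add: ennreal_plus)
    finally show "(\<integral>\<^sup>+y. u y * ennreal (h y * g y) \<partial>count_space UNIV) \<le> ennreal (N * (A + 1)) + ennreal e" .
  qed
qed

subsection \<open>The one-dimensional kernel\<close>

definition kappa :: "int \<Rightarrow> real" where
  "kappa a = 1 / (1 + \<bar>real_of_int a\<bar>)"

lemma kappa_nonneg: "0 \<le> kappa a" and kappa_le_1: "kappa a \<le> 1"
  by (auto simp: kappa_def)

text \<open>With \<open>s = 1 + |x - y|\<close> and \<open>t = 1 + |y|\<close>, partial fractions
  give \<open>1 / (s * t) = (1 / s + 1 / t) / (s + t)\<close>, and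
  \<open>1 + |x| \<le> s + t\<close> by the triangle inequality.\<close>

lemma kappa_mult_le: "kappa (x - y) * kappa y \<le> kappa x * (kappa (x - y) + kappa y)"
proof -
  define s where "s = 1 + \<bar>real_of_int (x - y)\<bar>"
  define t where "t = 1 + \<bar>real_of_int y\<bar>"
  have st: "s \<ge> 1" "t \<ge> 1" by (auto simp: s_def t_def)
  have "(1 + \<bar>real_of_int x\<bar>) \<le> s + t" by (auto simp: s_def t_def)
  hence "1 / (s + t) \<le> kappa x" unfolding kappa_def by (intro divide_left_mono) auto
  hence "1 / (s + t) * (kappa (x - y) + kappa y) \<le> kappa x * (kappa (x - y) + kappa y)"
    by (intro mult_right_mono add_nonneg_nonneg kappa_nonneg)
  moreover have "1 / (s + t) * (kappa (x - y) + kappa y) = kappa (x - y) * kappa y"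
    unfolding kappa_def s_def[symmetric] t_def[symmetric] using st by (simp add: field_simps)
  ultimately show ?thesis by simp
qed

text \<open>Each half-line carries a convergent series of powers. The two halves overlap at 0, which
  is harmless because only summability is transferred to their union.\<close>

lemma nn_integral_kappa_powr_finite:
  assumes q: "1 < q"
  obtains A where "0 \<le> A" "(\<integral>\<^sup>+y. ennreal (kappa y powr q) \<partial>count_space UNIV) = ennreal A"
proof -
  let ?g = "\<lambda>a. kappa a powr q"
  have "summable (\<lambda>n. real (Suc n) powr (- q))"
    using q by (subst summable_Suc_iff) (simp add: summable_real_powr_iff)
  also have "(\<lambda>n. real (Suc n) powr (- q)) = (\<lambda>n. ?g (int n))"
    by (auto simp: kappa_def powr_minus powr_divide field_simps)
  finally have nat: "(\<lambda>n. ?g (int n)) summable_on UNIV"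
    by (intro norm_summable_imp_summable_on) simp
  have pos: "?g summable_on range int"
    using nat by (subst summable_on_reindex) (auto simp: o_def)
  have neg: "?g summable_on range (\<lambda>n. - int n)"
    using nat by (subst summable_on_reindex) (auto simp: o_def inj_on_def kappa_def)
  have "range int \<union> range (\<lambda>n. - int n) = UNIV"
  proof (intro set_eqI iffI UNIV_I)
    fix a :: int
    show "a \<in> range int \<union> range (\<lambda>n. - int n)" by (cases a rule: int_cases2) auto
  qed
  hence "?g summable_on UNIV"
    using summable_on_union[OF pos neg] by simp
  from infsum_real_eq_nn_integral[OF this] show ?thesis
    by (intro that[of "infsum ?g UNIV"]) (auto intro!: infsum_nonneg)
qed

text \<open>Up to a constant this is \<open>(kappa (x - y))^2\<close> times the ratio of the weights
  at \<open>x\<close> and \<open>y\<close>. The first term bounds the part of the ratio that is at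
  most 1; in the second, the increment \<open>|x - y|\<close> of the weight has consumed one factor
  \<open>kappa (x - y)\<close>, and \<open>kappa y\<close> stands for the reciprocal of the weight
  at \<open>y\<close>.\<close>

definition line_kernel :: "int \<Rightarrow> int \<Rightarrow> real" where
  "line_kernel x y = (kappa (x - y))\<^sup>2 + kappa (x - y) * kappa y"

lemma line_kernel_nonneg: "0 \<le> line_kernel x y"
  by (simp add: line_kernel_def kappa_nonneg)

lemma line_kernel_le: "line_kernel x y \<le> (kappa (x - y))\<^sup>2 + kappa x * (kappa (x - y) + kappa y)"
  using kappa_mult_le[of x y] by (simp add: line_kernel_def)

lemma nn_integral_kappa_square_finite:
  obtains A where "0 \<le> A" "(\<integral>\<^sup>+y. ennreal ((kappa y)\<^sup>2) \<partial>count_space UNIV) = ennreal A"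
proof -
  obtain A where "0 \<le> A" "(\<integral>\<^sup>+y. ennreal (kappa y powr 2) \<partial>count_space UNIV) = ennreal A"
    by (rule nn_integral_kappa_powr_finite[of 2]) auto
  thus ?thesis by (intro that) (simp_all add: kappa_nonneg powr_numeral)
qed

text \<open>The row bound needed for exponent infinity. From \<open>a * b \<le> a^2 + b^2\<close>
  the kernel is at most \<open>2 * (kappa (x - y))^2 + (kappa y)^2\<close>, whose integral does not
  depend on \<open>x\<close> by translation invariance.\<close>

lemma line_kernel_integral_bounded:
  obtains A where "0 \<le> A" "\<And>x. (\<integral>\<^sup>+y. ennreal (line_kernel x y) \<partial>count_space UNIV) \<le> ennreal A"
proof -
  obtain A where A: "0 \<le> A" "(\<integral>\<^sup>+y. ennreal ((kappa y)\<^sup>2) \<partial>count_space UNIV) = ennreal A"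
    by (rule nn_integral_kappa_square_finite)
  have "(\<integral>\<^sup>+y. ennreal (line_kernel x y) \<partial>count_space UNIV) \<le> ennreal (3 * A)" for x
  proof -
    have "line_kernel x y \<le> 2 * (kappa (x - y))\<^sup>2 + (kappa y)\<^sup>2" for y
    proof -
      have "0 \<le> (kappa (x - y) - kappa y)\<^sup>2 + (kappa (x - y))\<^sup>2 + (kappa y)\<^sup>2" by simp
      thus ?thesis by (simp add: line_kernel_def power2_eq_square algebra_simps)
    qed
    hence "(\<integral>\<^sup>+y. ennreal (line_kernel x y) \<partial>count_space UNIV) \<le>
      (\<integral>\<^sup>+y. 2 * ennreal ((kappa (x - y))\<^sup>2) + ennreal ((kappa y)\<^sup>2) \<partial>count_space UNIV)"
      by (intro nn_integral_mono) (simp add: ennreal_mult'[symmetric] ennreal_plus[symmetric] ennreal_leI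
            flip: ennreal_numeral del: ennreal_plus)
    also have "\<dots> = 2 * ennreal A + ennreal A"
      by (simp add: nn_integral_add nn_integral_cmult A
          nn_integral_count_space_diff(1)[of "\<lambda>y. ennreal ((kappa y)\<^sup>2)"])
    also have "\<dots> = ennreal (3 * A)"
      using A by (simp add: ennreal_mult'[symmetric] ennreal_plus[symmetric] flip: ennreal_numeral del: ennreal_plus)
    finally show ?thesis .
  qed
  thus ?thesis using A(1) by (intro that[of "3 * A"]) auto
qed

lemma nn_integral_kappa_square_conv_le:
  fixes G :: "int \<Rightarrow> ennreal"
  assumes A: "(\<integral>\<^sup>+y. ennreal ((kappa y)\<^sup>2) \<partial>count_space UNIV) = ennreal A"
  shows "(\<integral>\<^sup>+x. (\<integral>\<^sup>+y. ennreal ((kappa (x - y))\<^sup>2) * G y \<partial>count_space UNIV) \<partial>count_space UNIV)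
      = ennreal A * (\<integral>\<^sup>+y. G y \<partial>count_space UNIV)"
  by (subst nn_integral_count_space_swap)
     (simp add: nn_integral_multc nn_integral_cmult A
          nn_integral_count_space_diff(2)[of "\<lambda>y. ennreal ((kappa y)\<^sup>2)"])

text \<open>By \<open>line_kernel_le\<close> the factor \<open>kappa x\<close> leaves the integral.
  The two integrals that it multiplies then only need bounds uniform in \<open>x\<close>, since all
  further decay in \<open>x\<close> is carried by \<open>kappa x\<close>.\<close>

lemma line_kernel_integral_split:
  assumes G0: "\<And>y. 0 \<le> G y"
  shows "(\<integral>\<^sup>+y. ennreal (line_kernel x y * G y) \<partial>count_space UNIV) \<le>
     (\<integral>\<^sup>+y. ennreal ((kappa (x - y))\<^sup>2) * ennreal (G y) \<partial>count_space UNIV) +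
     ennreal (kappa x) * ((\<integral>\<^sup>+y. ennreal (kappa (x - y) * G y) \<partial>count_space UNIV) +
        (\<integral>\<^sup>+y. ennreal (kappa y * G y) \<partial>count_space UNIV))"
proof -
  have "(\<integral>\<^sup>+y. ennreal (line_kernel x y * G y) \<partial>count_space UNIV) \<le>
     (\<integral>\<^sup>+y. ennreal ((kappa (x - y))\<^sup>2) * ennreal (G y) +
     ennreal (kappa x) * (ennreal (kappa (x - y) * G y) + ennreal (kappa y * G y)) \<partial>count_space UNIV)"
  proof (rule nn_integral_mono)
    fix y
    have "line_kernel x y * G y \<le> ((kappa (x - y))\<^sup>2 + kappa x * (kappa (x - y) + kappa y)) * G y"
      by (intro mult_right_mono line_kernel_le G0)
    also have "\<dots> = (kappa (x - y))\<^sup>2 * G y + kappa x * (kappa (x - y) * G y + kappa y * G y)"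
      by (simp add: algebra_simps)
    finally show "ennreal (line_kernel x y * G y) \<le> ennreal ((kappa (x - y))\<^sup>2) * ennreal (G y) +
      ennreal (kappa x) * (ennreal (kappa (x - y) * G y) + ennreal (kappa y * G y))"
      by (simp add: ennreal_mult[symmetric] ennreal_plus[symmetric] G0 kappa_nonneg ennreal_leI del: ennreal_plus)
  qed
  also have "\<dots> = (\<integral>\<^sup>+y. ennreal ((kappa (x - y))\<^sup>2) * ennreal (G y) \<partial>count_space UNIV) +
     ennreal (kappa x) * ((\<integral>\<^sup>+y. ennreal (kappa (x - y) * G y) \<partial>count_space UNIV) +
        (\<integral>\<^sup>+y. ennreal (kappa y * G y) \<partial>count_space UNIV))"
    by (simp add: nn_integral_add nn_integral_cmult)
  finally show ?thesis .
qed

lemma powr_add_le: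
  fixes a b p :: real
  assumes "0 \<le> a" "0 \<le> b" "0 \<le> p"
  shows "(a + b) powr p \<le> 2 powr p * (a powr p + b powr p)"
proof -
  have "(a + b) powr p \<le> (2 * max a b) powr p"
    using assms by (intro powr_mono2) auto
  also have "\<dots> = 2 powr p * max a b powr p" using assms by (simp add: powr_mult)
  also have "\<dots> \<le> 2 powr p * (a powr p + b powr p)"
    by (intro mult_left_mono) (auto simp: max_def)
  finally show ?thesis .
qed

text \<open>The convolution term is estimated pointwise by Hoelder and then summed by Tonelli; the
  other term is at most a multiple of \<open>kappa x\<close>, whose \<open>p\<close>-th power is
  summable. \<open>F\<close> is merely dominated by the integral, and \<open>C\<close> precedes
  \<open>F\<close> and \<open>G\<close>, so one constant serves all lines.\<close>

lemma line_kernel_lp_bounded: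
  assumes p: "1 < p"
  obtains C where "0 < C"
    "\<And>F G. (\<And>x. 0 \<le> F x) \<Longrightarrow> (\<And>x. 0 \<le> G x) \<Longrightarrow>
      (\<And>x. ennreal (F x) \<le> (\<integral>\<^sup>+y. ennreal (line_kernel x y * G y) \<partial>count_space UNIV)) \<Longrightarrow>
      (\<integral>\<^sup>+x. ennreal (F x powr p) \<partial>count_space UNIV) \<le>
        ennreal C * (\<integral>\<^sup>+x. ennreal (G x powr p) \<partial>count_space UNIV)"
proof -
  define q where "q = p / (p - 1)"
  have q: "1 < q" "1 / p + 1 / q = 1"
    using p by (auto simp: q_def field_simps)
  obtain A where A: "0 \<le> A" "(\<integral>\<^sup>+y. ennreal ((kappa y)\<^sup>2) \<partial>count_space UNIV) = ennreal A"
    by (rule nn_integral_kappa_square_finite)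
  obtain Ap where Ap: "0 \<le> Ap" "(\<integral>\<^sup>+y. ennreal (kappa y powr p) \<partial>count_space UNIV) = ennreal Ap"
    by (rule nn_integral_kappa_powr_finite[OF p])
  obtain Aq where Aq: "0 \<le> Aq" "(\<integral>\<^sup>+y. ennreal (kappa y powr q) \<partial>count_space UNIV) = ennreal Aq"
    by (rule nn_integral_kappa_powr_finite[OF q(1)])
  \<comment> \<open>The two summands come from the convolution term and the \<open>kappa x\<close>
    term, and \<open>2 powr p\<close> from \<open>powr_add_le\<close>. Adding 1 makes
    \<open>C\<close> positive, so that \<open>ennreal C\<close> times infinity is infinity.\<close>
  define C where "C = 2 powr p * ((A + 1) powr p * A + (2 * (Aq + 1)) powr p * Ap) + 1"
  have C: "0 < C" using A Ap by (auto simp: C_def intro!: add_nonneg_pos)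
  show ?thesis
  proof (rule that[OF C])
    fix F G :: "int \<Rightarrow> real"
    assume F0: "\<And>x. 0 \<le> F x" and G0: "\<And>x. 0 \<le> G x"
      and FG: "\<And>x. ennreal (F x) \<le> (\<integral>\<^sup>+y. ennreal (line_kernel x y * G y) \<partial>count_space UNIV)"
    let ?I = "\<integral>\<^sup>+x. ennreal (G x powr p) \<partial>count_space UNIV"
    show "(\<integral>\<^sup>+x. ennreal (F x powr p) \<partial>count_space UNIV) \<le> ennreal C * ?I"
    proof (cases "?I = \<infinity>")
      case True
      thus ?thesis using C by (simp add: ennreal_mult_eq_top_iff)
    next
      case False
      define S where "S = enn2real ?I"
      have S: "0 \<le> S" "?I = ennreal S" using False by (auto simp: S_def top.not_eq_extremum)
      define N where "N = S powr (1 / p)"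
      have N: "0 \<le> N" "N powr p = S" using S p by (auto simp: N_def powr_powr)
      define J where "J x = (\<integral>\<^sup>+y. ennreal ((kappa (x - y))\<^sup>2) * ennreal (G y powr p) \<partial>count_space UNIV)" for x
      have J_sum: "(\<integral>\<^sup>+x. J x \<partial>count_space UNIV) = ennreal A * ?I"
        unfolding J_def by (rule nn_integral_kappa_square_conv_le[OF A(2)])
      have J_fin: "J x \<noteq> \<infinity>" for x
      proof -
        have "J x \<le> ?I" unfolding J_def
          by (intro nn_integral_mono)
             (simp add: ennreal_mult[symmetric] ennreal_leI mult_left_le_one_le power_le_one kappa_nonneg kappa_le_1)
        thus ?thesis using False by (auto simp: top_unique)
      qed
      define R where "R x = enn2real (J x)" for x
      have R: "0 \<le> R x" "J x = ennreal (R x)" for x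
        using J_fin[of x] by (auto simp: R_def top.not_eq_extremum)
      \<comment> \<open>Hoelder with weight \<open>u y = (kappa (x - y))^2\<close> and
        \<open>h = 1\<close>: the convolution with \<open>G\<close> is controlled by the
        \<open>p\<close>-th root of the convolution with \<open>G powr p\<close>, which sums over
        \<open>x\<close> to \<open>A\<close> times the power sum of \<open>G\<close>.\<close>
      have T1: "(\<integral>\<^sup>+y. ennreal ((kappa (x - y))\<^sup>2) * ennreal (1 * G y) \<partial>count_space UNIV)
          \<le> ennreal (R x powr (1 / p) * (A + 1))" for x
      proof (rule nn_integral_count_space_Holder[OF p q(2)])
        show "(\<integral>\<^sup>+y. ennreal ((kappa (x - y))\<^sup>2) * ennreal (1 powr q) \<partial>count_space UNIV) \<le> ennreal A"
          by (simp add: A nn_integral_count_space_diff(1)[of "\<lambda>y. ennreal ((kappa y)\<^sup>2)"])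
        show "(\<integral>\<^sup>+y. ennreal ((kappa (x - y))\<^sup>2) * ennreal (G y powr p) \<partial>count_space UNIV)
          \<le> ennreal ((R x powr (1 / p)) powr p)"
          using p R(1)[of x] R(2)[of x] by (simp add: J_def powr_powr)
      qed (auto simp: G0 A)
      \<comment> \<open>Here \<open>u = 1\<close>, and \<open>h\<close> will be \<open>kappa\<close>
        or a reflected translate of it. Both have the same integral of \<open>h powr q\<close>,
        which makes the bound uniform in \<open>x\<close>.\<close>
      have T2: "(\<integral>\<^sup>+y. 1 * ennreal (h y * G y) \<partial>count_space UNIV) \<le> ennreal (N * (Aq + 1))"
        if "\<And>y. 0 \<le> h y" "(\<integral>\<^sup>+y. ennreal (h y powr q) \<partial>count_space UNIV) = ennreal Aq" for h
        by (rule nn_integral_count_space_Holder[OF p q(2)]) (auto simp: G0 that N S Aq)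
      have F_le: "F x \<le> R x powr (1 / p) * (A + 1) + kappa x * (2 * (Aq + 1)) * N" for x
      proof -
        have "ennreal (F x) \<le> ennreal (R x powr (1 / p) * (A + 1)) +
            ennreal (kappa x) * (ennreal (N * (Aq + 1)) + ennreal (N * (Aq + 1)))"
        proof (rule order_trans[OF order_trans[OF FG line_kernel_integral_split]])
          show "(\<integral>\<^sup>+y. ennreal ((kappa (x - y))\<^sup>2) * ennreal (G y) \<partial>count_space UNIV) +
             ennreal (kappa x) * ((\<integral>\<^sup>+y. ennreal (kappa (x - y) * G y) \<partial>count_space UNIV) +
                (\<integral>\<^sup>+y. ennreal (kappa y * G y) \<partial>count_space UNIV)) \<le> 
              ennreal (R x powr (1 / p) * (A + 1)) +
            ennreal (kappa x) * (ennreal (N * (Aq + 1)) + ennreal (N * (Aq + 1)))"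
            using T1[of x] T2[of "\<lambda>y. kappa (x - y)"] T2[of kappa]
            by (intro add_mono mult_left_mono)
               (auto simp: kappa_nonneg Aq nn_integral_count_space_diff(1)[of "\<lambda>y. ennreal (kappa y powr q)"])
        qed (rule G0)
        also have "\<dots> = ennreal (R x powr (1 / p) * (A + 1) + kappa x * (2 * (Aq + 1)) * N)"
          using N A Aq by (simp add: ennreal_mult[symmetric] ennreal_plus[symmetric] kappa_nonneg algebra_simps del: ennreal_plus)
        finally show ?thesis
          using N A Aq by (subst (asm) ennreal_le_iff) (auto intro!: add_nonneg_nonneg mult_nonneg_nonneg kappa_nonneg)
      qed
      have "(\<integral>\<^sup>+x. ennreal (F x powr p) \<partial>count_space UNIV) \<le>
         (\<integral>\<^sup>+x. ennreal (2 powr p * (A + 1) powr p) * J x +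
            ennreal (2 powr p * (2 * (Aq + 1)) powr p * S) * ennreal (kappa x powr p) \<partial>count_space UNIV)"
      proof (rule nn_integral_mono)
        fix x
        have "F x powr p \<le> (R x powr (1 / p) * (A + 1) + kappa x * (2 * (Aq + 1)) * N) powr p"
          using p F0 F_le by (intro powr_mono2) auto
        also have "\<dots> \<le> 2 powr p * ((R x powr (1 / p) * (A + 1)) powr p + (kappa x * (2 * (Aq + 1)) * N) powr p)"
          using p A Aq N by (intro powr_add_le mult_nonneg_nonneg kappa_nonneg) auto
        also have "\<dots> = (2 powr p * (A + 1) powr p) * R x +
            (2 powr p * (2 * (Aq + 1)) powr p * S) * kappa x powr p"
        proof -
          have "(R x powr (1 / p) * (A + 1)) powr p = R x * (A + 1) powr p"
            using p A R(1)[of x] by (simp add: powr_mult powr_powr)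
          moreover have "(kappa x * (2 * (Aq + 1)) * N) powr p = kappa x powr p * (2 * (Aq + 1)) powr p * S"
            using p Aq N kappa_nonneg[of x] by (simp add: powr_mult)
          ultimately show ?thesis by (simp add: algebra_simps)
        qed
        finally show "ennreal (F x powr p) \<le> ennreal (2 powr p * (A + 1) powr p) * J x +
            ennreal (2 powr p * (2 * (Aq + 1)) powr p * S) * ennreal (kappa x powr p)"
          using S R(1) by (simp add: R(2) ennreal_mult[symmetric] ennreal_plus[symmetric] ennreal_leI del: ennreal_plus)
      qed
      also have "\<dots> = ennreal (2 powr p * (A + 1) powr p) * (ennreal A * ennreal S) +
            ennreal (2 powr p * (2 * (Aq + 1)) powr p * S) * ennreal Ap"
        by (simp add: nn_integral_add nn_integral_cmult J_sum S Ap)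
      also have "\<dots> = ennreal ((C - 1) * S)"
        using A Ap S by (simp add: C_def ennreal_mult[symmetric] ennreal_plus[symmetric] algebra_simps del: ennreal_plus)
      also have "\<dots> \<le> ennreal C * ?I"
        using C S by (simp add: ennreal_mult[symmetric] algebra_simps ennreal_leI)
      finally show ?thesis .
    qed
  qed
qed

text \<open>This is the weak bound for \<open>kappa\<close>, as the condition says
  \<open>1 / t \<le> kappa x\<close> when \<open>t > 0\<close>. For \<open>t < 1\<close> the set is
  empty, which also covers negative \<open>t\<close>, where \<open>ennreal\<close> truncates to
  0.\<close>

lemma emeasure_int_ball_le: "emeasure (count_space UNIV) {x::int. 1 + \<bar>real_of_int x\<bar> \<le> t} \<le> ennreal (2 * t)"
proof (cases "1 \<le> t")
  case True
  define n where "n = \<lfloor>t\<rfloor>"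
  have n: "1 \<le> n" "real_of_int n \<le> t" using True by (auto simp: n_def)
  have sub: "{x::int. 1 + \<bar>real_of_int x\<bar> \<le> t} \<subseteq> {1 - n..n - 1}"
  proof
    fix x :: int assume "x \<in> {x. 1 + \<bar>real_of_int x\<bar> \<le> t}"
    hence "real_of_int (1 + \<bar>x\<bar>) \<le> t" by simp
    hence "1 + \<bar>x\<bar> \<le> n" by (simp only: n_def le_floor_iff)
    thus "x \<in> {1 - n..n - 1}" by auto
  qed
  have "emeasure (count_space UNIV) {x::int. 1 + \<bar>real_of_int x\<bar> \<le> t} \<le> emeasure (count_space UNIV) {1 - n..n - 1}"
    by (rule emeasure_mono[OF sub]) simp
  also have "\<dots> = ennreal (real_of_int (2 * n - 1))"
    using n by (subst emeasure_count_space_finite) (auto simp: ennreal_of_nat_eq_real_of_nat of_nat_nat)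
  also have "\<dots> \<le> ennreal (2 * t)" using n by (intro ennreal_leI) simp
  finally show ?thesis .
next
  case False
  hence "{x::int. 1 + \<bar>real_of_int x\<bar> \<le> t} = {}" by auto
  thus ?thesis by simp
qed

text \<open>The level is halved between the two terms. Markov's inequality at level
  \<open>\<alpha> / 2\<close> for the summable convolution term gives \<open>2 * A\<close>; counting
  the integers with \<open>\<alpha> / 2 \<le> 2 * S * kappa x\<close> gives 8.\<close>

lemma line_kernel_weak_bounded:
  obtains C where "0 < C"
    "\<And>F G \<alpha>. 0 < \<alpha> \<Longrightarrow> (\<And>x. 0 \<le> G x) \<Longrightarrow>
      (\<And>x. ennreal (F x) \<le> (\<integral>\<^sup>+y. ennreal (line_kernel x y * G y) \<partial>count_space UNIV)) \<Longrightarrow>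
      ennreal \<alpha> * emeasure (count_space UNIV) {x. \<alpha> \<le> F x} \<le>
        ennreal C * (\<integral>\<^sup>+x. ennreal (G x) \<partial>count_space UNIV)"
proof -
  obtain A where A: "0 \<le> A" "(\<integral>\<^sup>+y. ennreal ((kappa y)\<^sup>2) \<partial>count_space UNIV) = ennreal A"
    by (rule nn_integral_kappa_square_finite)
  have C: "0 < 2 * A + 8" using A by simp
  show ?thesis
  proof (rule that[OF C])
    fix F G :: "int \<Rightarrow> real" and \<alpha> :: real
    assume \<alpha>: "0 < \<alpha>" and G0: "\<And>x. 0 \<le> G x"
      and FG: "\<And>x. ennreal (F x) \<le> (\<integral>\<^sup>+y. ennreal (line_kernel x y * G y) \<partial>count_space UNIV)"
    let ?I = "\<integral>\<^sup>+x. ennreal (G x) \<partial>count_space UNIV"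
    show "ennreal \<alpha> * emeasure (count_space UNIV) {x. \<alpha> \<le> F x} \<le> ennreal (2 * A + 8) * ?I"
    proof (cases "?I = \<infinity>")
      case True
      thus ?thesis using C by (simp add: ennreal_mult_eq_top_iff)
    next
      case False
      define S where "S = enn2real ?I"
      have S: "0 \<le> S" "?I = ennreal S" using False by (auto simp: S_def top.not_eq_extremum)
      define T where "T x = (\<integral>\<^sup>+y. ennreal ((kappa (x - y))\<^sup>2) * ennreal (G y) \<partial>count_space UNIV)" for x
      have T_sum: "(\<integral>\<^sup>+x. T x \<partial>count_space UNIV) = ennreal A * ?I"
        unfolding T_def by (rule nn_integral_kappa_square_conv_le[OF A(2)])
      have T2: "(\<integral>\<^sup>+y. ennreal (kappa (h y) * G y) \<partial>count_space UNIV) \<le> ennreal S" for h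
        unfolding S(2)[symmetric]
        by (intro nn_integral_mono ennreal_leI) (simp add: G0 mult_left_le_one_le kappa_nonneg kappa_le_1)
      have F_le: "ennreal (F x) \<le> T x + ennreal (2 * S * kappa x)" for x
      proof -
        have "ennreal (F x) \<le> T x + ennreal (kappa x) * (ennreal S + ennreal S)"
          by (rule order_trans[OF order_trans[OF FG line_kernel_integral_split]])
             (auto simp: G0 T_def intro!: add_mono mult_left_mono T2)
        also have "ennreal (kappa x) * (ennreal S + ennreal S) = ennreal (2 * S * kappa x)"
          using S by (simp add: ennreal_mult[symmetric] ennreal_plus[symmetric] kappa_nonneg algebra_simps del: ennreal_plus)
        finally show ?thesis .
      qed
      have "{x. \<alpha> \<le> F x} \<subseteq> {x \<in> UNIV. 1 \<le> ennreal (2 / \<alpha>) * T x} \<union> {x. 1 + \<bar>real_of_int x\<bar> \<le> 4 * S / \<alpha>}"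
      proof
        fix x assume "x \<in> {x. \<alpha> \<le> F x}"
        hence le: "ennreal \<alpha> \<le> T x + ennreal (2 * S * kappa x)"
          using F_le[of x] by (auto intro: order_trans ennreal_leI)
        show "x \<in> {x \<in> UNIV. 1 \<le> ennreal (2 / \<alpha>) * T x} \<union> {x. 1 + \<bar>real_of_int x\<bar> \<le> 4 * S / \<alpha>}"
        proof (cases "\<alpha> / 2 \<le> 2 * S * kappa x")
          case True
          hence "1 + \<bar>real_of_int x\<bar> \<le> 4 * S / \<alpha>"
            using \<alpha> by (simp add: kappa_def field_simps)
          thus ?thesis by simp
        next
          case False
          have "ennreal (\<alpha> / 2) + ennreal (\<alpha> / 2) \<le> T x + ennreal (\<alpha> / 2)"
            using le False \<alpha> by (auto simp: ennreal_plus[symmetric] simp del: ennreal_plus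
                intro: order_trans add_left_mono ennreal_leI)
          \<comment> \<open>Cancellation is legitimate because \<open>ennreal (\<alpha> / 2)\<close>
            is finite.\<close>
          hence "ennreal (\<alpha> / 2) \<le> T x"
            by (subst (asm) add.commute[of "T x"]) (simp add: ennreal_add_left_cancel_le)
          hence "ennreal (2 / \<alpha>) * ennreal (\<alpha> / 2) \<le> ennreal (2 / \<alpha>) * T x"
            by (rule mult_left_mono) simp
          thus ?thesis using \<alpha> by (simp add: ennreal_mult[symmetric])
        qed
      qed
      hence "emeasure (count_space UNIV) {x. \<alpha> \<le> F x} \<le>
         emeasure (count_space UNIV) ({x \<in> UNIV. 1 \<le> ennreal (2 / \<alpha>) * T x} \<union> {x. 1 + \<bar>real_of_int x\<bar> \<le> 4 * S / \<alpha>})"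
        by (rule emeasure_mono) simp
      also have "\<dots> \<le> emeasure (count_space UNIV) {x \<in> UNIV. 1 \<le> ennreal (2 / \<alpha>) * T x} +
          emeasure (count_space UNIV) {x::int. 1 + \<bar>real_of_int x\<bar> \<le> 4 * S / \<alpha>}"
        by (rule emeasure_subadditive) auto
      also have "\<dots> \<le> ennreal (2 / \<alpha>) * (ennreal A * ennreal S) + ennreal (2 * (4 * S / \<alpha>))"
        using nn_integral_Markov_inequality[where M = "count_space UNIV" and u = T and A = UNIV
            and c = "ennreal (2 / \<alpha>)"]
        by (intro add_mono emeasure_int_ball_le) (simp add: T_sum S)
      also have "\<dots> = ennreal ((2 * A + 8) * S / \<alpha>)"
        using S A \<alpha> by (simp add: ennreal_mult[symmetric] ennreal_plus[symmetric] field_simps del: ennreal_plus)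
      finally have "ennreal \<alpha> * emeasure (count_space UNIV) {x. \<alpha> \<le> F x} \<le> ennreal \<alpha> * ennreal ((2 * A + 8) * S / \<alpha>)"
        by (rule mult_left_mono) simp
      also have "\<dots> = ennreal (2 * A + 8) * ?I"
        using S A \<alpha> by (simp add: ennreal_mult[symmetric] del: ennreal_plus)
      finally show ?thesis .
    qed
  qed
qed

subsection \<open>Reduction to lines\<close>

text \<open>The hyperplane \<open>m $ j = 0\<close> meets each line parallel to the
  \<open>j\<close>-th axis exactly once, so it indexes the lines, and the \<open>j\<close>-th
  coordinate is the parameter on each of them.\<close>

lemma nn_integral_lines:
  fixes H :: "int ^ 'd::finite \<Rightarrow> ennreal"
  shows "(\<integral>\<^sup>+k. H k \<partial>count_space UNIV) =
    (\<integral>\<^sup>+m\<in>{m. m $ j = 0}. (\<integral>\<^sup>+x. H (m + axis j x) \<partial>count_space UNIV) \<partial>count_space UNIV)"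
proof -
  let ?S = "{m :: int ^ 'd. m $ j = 0} \<times> (UNIV :: int set)"
  have bij: "bij_betw (\<lambda>(m, x). m + axis j x) ?S UNIV"
    by (rule bij_betwI[where g = "\<lambda>k. (k - axis j (k $ j), k $ j)"])
       (auto simp: vec_eq_iff axis_def)
  have "(\<integral>\<^sup>+k. H k \<partial>count_space UNIV) = (\<integral>\<^sup>+z. H (case z of (m, x) \<Rightarrow> m + axis j x) \<partial>count_space ?S)"
    by (rule nn_integral_bij_count_space[OF bij, symmetric])
  also have "\<dots> = (\<integral>\<^sup>+z. H (case z of (m, x) \<Rightarrow> m + axis j x) * indicator ?S z \<partial>count_space UNIV)"
    by (rule nn_integral_count_space_indicator) simp
  also have "\<dots> = (\<integral>\<^sup>+m. \<integral>\<^sup>+x. H (m + axis j x) * indicator {m. m $ j = 0} m \<partial>count_space UNIV \<partial>count_space UNIV)"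
    by (subst nn_integral_fst_count_space[symmetric]) (simp add: indicator_times)
  also have "\<dots> = (\<integral>\<^sup>+m\<in>{m. m $ j = 0}. (\<integral>\<^sup>+x. H (m + axis j x) \<partial>count_space UNIV) \<partial>count_space UNIV)"
    by (subst nn_integral_multc) simp_all
  finally show ?thesis .
qed

lemma nn_integral_lines_mono:
  fixes H1 H2 :: "int ^ 'd::finite \<Rightarrow> ennreal"
  assumes "\<And>m. m $ j = 0 \<Longrightarrow> (\<integral>\<^sup>+x. H1 (m + axis j x) \<partial>count_space UNIV) \<le>
      c * (\<integral>\<^sup>+x. H2 (m + axis j x) \<partial>count_space UNIV)"
  shows "(\<integral>\<^sup>+k. H1 k \<partial>count_space UNIV) \<le> c * (\<integral>\<^sup>+k. H2 k \<partial>count_space UNIV)"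
proof -
  have "(\<integral>\<^sup>+k. H1 k \<partial>count_space UNIV) \<le>
     (\<integral>\<^sup>+m. c * ((\<integral>\<^sup>+x. H2 (m + axis j x) \<partial>count_space UNIV) * indicator {m. m $ j = 0} m) \<partial>count_space UNIV)"
    unfolding nn_integral_lines[of H1 j]
    by (intro nn_integral_mono) (auto split: split_indicator intro: assms)
  also have "\<dots> = c * (\<integral>\<^sup>+k. H2 k \<partial>count_space UNIV)"
    unfolding nn_integral_lines[of H2 j] by (simp add: nn_integral_cmult)
  finally show ?thesis .
qed

section \<open>The weight and the kernel along an axis\<close>

text \<open>\<open>bracket m\<close> is the Euclidean norm of the pair \<open>(1, m)\<close>, so
  this is the triangle inequality after adding \<open>(0, axis j a)\<close>.\<close>

lemma bracket_add_axis_le: "bracket (m + axis j a) \<le> bracket m + \<bar>real_of_int a\<bar>"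
proof -
  let ?R = "\<lambda>m :: int ^ 'a. (\<chi> i. real_of_int (m $ i))"
  have R: "?R (m + axis j a) = ?R m + axis j (real_of_int a)"
    by (auto simp: vec_eq_iff axis_def)
  have "norm ((1::real, ?R m) + (0, axis j (real_of_int a))) \<le>
      norm (1::real, ?R m) + norm (0::real, axis j (real_of_int a) :: real ^ 'a)"
    by (rule norm_triangle_ineq)
  also have "(1::real, ?R m) + (0, axis j (real_of_int a)) = (1, ?R (m + axis j a))"
    by (simp only: R add_Pair add_0_right)
  also have "norm (0::real, axis j (real_of_int a) :: real ^ 'a) = \<bar>real_of_int a\<bar>"
    by (simp add: norm_eq_sqrt_inner inner_axis_axis)
  finally show ?thesis
    by (simp only: bracket_def norm_Pair) simp
qed

lemma component_le_bracket: "\<bar>real_of_int (m $ j)\<bar> \<le> bracket m"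
proof -
  have "\<bar>real_of_int (m $ j)\<bar> \<le> norm ((\<chi> i. of_int (m $ i)) :: real ^ 'a)"
    using component_le_norm_cart[of "(\<chi> i. of_int (m $ i)) :: real ^ 'a" j] by simp
  also have "\<dots> \<le> bracket m" by (simp add: bracket_def real_le_rsqrt)
  finally show ?thesis .
qed

lemma norm_deriv_kernel_axis:
  "norm (deriv_kernel j (axis j a)) = 4 / (pi * \<bar>4 * (real_of_int a)\<^sup>2 - 1\<bar>)"
proof -
  have "(4 * (of_int a)\<^sup>2 - 1 :: complex) = of_real (4 * (real_of_int a)\<^sup>2 - 1)"
    by simp
  thus ?thesis
    by (simp only: deriv_kernel_axis norm_divide norm_mult norm_of_real) simp
qed

text \<open>For \<open>x = |a| \<ge> 1\<close> one has
  \<open>(1 + x)^2 / 2 \<le> 2 * x^2 \<le> 4 * x^2 - 1\<close>. At \<open>a = 0\<close> the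
  denominator changes sign and is checked directly.\<close>

lemma norm_deriv_kernel_axis_le: "norm (deriv_kernel j (axis j a)) \<le> 8 * (kappa a)\<^sup>2"
proof -
  define x where "x = \<bar>real_of_int a\<bar>"
  have le: "(1 + x)\<^sup>2 / 2 \<le> \<bar>4 * (real_of_int a)\<^sup>2 - 1\<bar>"
  proof (cases "a = 0")
    case False
    hence "x \<ge> 1" unfolding x_def by linarith
    hence "1 + x \<le> 2 * x" by simp
    hence "(1 + x)\<^sup>2 \<le> (2 * x)\<^sup>2" using \<open>x \<ge> 1\<close> by (intro power_mono) auto
    moreover have "1 \<le> x\<^sup>2" using \<open>x \<ge> 1\<close> by (rule one_le_power)
    moreover have "(real_of_int a)\<^sup>2 = x\<^sup>2" by (simp add: x_def)
    ultimately show ?thesis by (simp add: power_mult_distrib)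
  qed (simp add: x_def)
  have "norm (deriv_kernel j (axis j a)) \<le> 4 / (1 * ((1 + x)\<^sup>2 / 2))"
    unfolding norm_deriv_kernel_axis using le pi_ge_two
    by (intro divide_left_mono mult_mono) (auto simp: x_def intro!: mult_pos_pos)
  also have "\<dots> = 8 * (kappa a)\<^sup>2"
    by (simp add: kappa_def x_def power_divide)
  finally show ?thesis .
qed

section \<open>The weighted norms as integrals and suprema of a real function\<close>

definition weighted_abs :: "(int ^ 'd \<Rightarrow> complex) \<Rightarrow> int ^ 'd \<Rightarrow> real" where
  "weighted_abs f k = norm (f k) * bracket k"

lemma weighted_abs_nonneg: "0 \<le> weighted_abs f k"
  using bracket_ge_1[of k] by (simp add: weighted_abs_def)

lemma weighted_abs_eq: "norm (f k * complex_of_real (bracket k powr 1)) = weighted_abs f k"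
  using bracket_ge_1[of k] by (simp add: weighted_abs_def norm_mult)

lemma weighted_lp_norm_infinity: "weighted_lp_norm \<infinity> 1 f = (SUP k. ennreal (weighted_abs f k))"
  by (simp only: weighted_lp_norm_def lp_norm_def weighted_abs_eq if_True simp_thms)

lemma weighted_lp_norm_finite:
  assumes "p \<noteq> \<infinity>"
  shows "weighted_lp_norm p 1 f =
    (let S = (\<integral>\<^sup>+k. ennreal (weighted_abs f k powr enn2real p) \<partial>count_space UNIV)
     in if S = \<infinity> then \<infinity> else ennreal (enn2real S powr (1 / enn2real p)))"
  using assms by (simp only: weighted_lp_norm_def lp_norm_def weighted_abs_eq infsum_ennreal_eq_nn_integral if_False)

lemma weighted_lp_norm_1:
  "weighted_lp_norm 1 1 f = (\<integral>\<^sup>+k. ennreal (weighted_abs f k) \<partial>count_space UNIV)"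
  by (subst weighted_lp_norm_finite) (auto simp: Let_def weighted_abs_nonneg top.not_eq_extremum)

text \<open>Takes \<open>p\<close>-th roots in a bound between power sums. \<open>lp_norm\<close>
  passes through \<open>enn2real\<close>, which sends infinity to 0; membership of \<open>f\<close>
  keeps both sums finite, so the roots can be compared.\<close>

lemma weighted_lp_norm_le:
  assumes p: "1 < p" "p \<noteq> \<infinity>" and C: "0 < C" and f: "f \<in> weighted_lp p 1"
    and le: "(\<integral>\<^sup>+k. ennreal (weighted_abs F k powr enn2real p) \<partial>count_space UNIV) \<le>
      ennreal C * (\<integral>\<^sup>+k. ennreal (weighted_abs f k powr enn2real p) \<partial>count_space UNIV)"
  shows "weighted_lp_norm p 1 F \<le> ennreal (C powr (1 / enn2real p)) * weighted_lp_norm p 1 f"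
proof -
  define S T where "S = (\<integral>\<^sup>+k. ennreal (weighted_abs F k powr enn2real p) \<partial>count_space UNIV)"
    and "T = (\<integral>\<^sup>+k. ennreal (weighted_abs f k powr enn2real p) \<partial>count_space UNIV)"
  have T: "T \<noteq> \<infinity>" using f p by (auto simp: weighted_lp_def weighted_lp_norm_finite T_def Let_def)
  have S: "S \<le> ennreal C * T" using le by (simp add: S_def T_def)
  moreover have fin: "ennreal C * T < \<infinity>" using T by (simp add: ennreal_mult_less_top top.not_eq_extremum)
  ultimately have S': "S \<noteq> \<infinity>" by auto
  have "enn2real S \<le> enn2real (ennreal C * T)" by (rule enn2real_mono[OF S]) (use fin in simp)
  also have "\<dots> = C * enn2real T" using C by (simp add: enn2real_mult)
  finally have "enn2real S powr (1 / enn2real p) \<le> (C * enn2real T) powr (1 / enn2real p)"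
    by (intro powr_mono2) auto
  also have "\<dots> = C powr (1 / enn2real p) * enn2real T powr (1 / enn2real p)"
    using C by (simp add: powr_mult)
  finally have *: "enn2real S powr (1 / enn2real p) \<le> C powr (1 / enn2real p) * enn2real T powr (1 / enn2real p)" .
  have "weighted_lp_norm p 1 F = ennreal (enn2real S powr (1 / enn2real p))"
    "weighted_lp_norm p 1 f = ennreal (enn2real T powr (1 / enn2real p))"
    using p S' T by (auto simp: weighted_lp_norm_finite S_def T_def Let_def)
  thus ?thesis using * by (simp add: ennreal_mult[symmetric] ennreal_leI)
qed

text \<open>The kernel vanishes off the axis, so only points of the line through \<open>m\<close>
  contribute. The constant 16 is the 8 from \<open>norm_deriv_kernel_axis_le\<close> times the 2
  lost in comparing \<open>1 + |y|\<close> with the weight at \<open>y\<close>.\<close>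

lemma discrete_partial_line_bound:
  assumes f: "f \<in> weighted_lp p 1" "1 \<le> p" and m: "m $ j = 0"
  shows "ennreal (weighted_abs (discrete_partial j f) (m + axis j x)) \<le>
    (\<integral>\<^sup>+y. ennreal (line_kernel x y * (16 * weighted_abs f (m + axis j y))) \<partial>count_space UNIV)"
proof -
  let ?L = "\<lambda>y. m + axis j y"
  let ?h = "\<lambda>n. norm (f n * deriv_kernel j (?L x - n))"
  have s: "?h summable_on UNIV"
    using f by (intro abs_summable_discrete_partial) auto
  have b: "1 \<le> bracket k" for k :: "int ^ 'a" by (rule bracket_ge_1)
  have b0: "0 \<le> bracket k" for k :: "int ^ 'a" using b[of k] by simp
  have "ennreal (weighted_abs (discrete_partial j f) (?L x)) \<le> ennreal (infsum ?h UNIV) * ennreal (bracket (?L x))"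
    unfolding weighted_abs_def discrete_partial_def lattice_convolution_def
    using norm_infsum_bound[OF s] b0
    by (subst ennreal_mult[symmetric]) (auto intro!: ennreal_leI mult_right_mono infsum_nonneg)
  also have "\<dots> = (\<integral>\<^sup>+n. ennreal (?h n * bracket (?L x)) \<partial>count_space UNIV)"
    by (subst infsum_real_eq_nn_integral[OF s]) (auto simp: nn_integral_multc[symmetric] ennreal_mult b0)
  also have "\<dots> = (\<integral>\<^sup>+n\<in>range ?L. ennreal (?h n * bracket (?L x)) \<partial>count_space UNIV)"
  proof (rule nn_integral_cong)
    fix n
    have "deriv_kernel j (?L x - n) = 0" if "n \<notin> range ?L"
    proof (rule deriv_kernel_off_axis, rule notI)
      assume "?L x - n \<in> range (axis j)"
      then obtain a where "?L x - n = axis j a" by auto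
      hence "n = ?L (x - a)" by (auto simp: vec_eq_iff axis_def algebra_simps split: if_splits)
      thus False using that by blast
    qed
    thus "ennreal (?h n * bracket (?L x)) = ennreal (?h n * bracket (?L x)) * indicator (range ?L) n"
      by (auto split: split_indicator)
  qed
  also have "\<dots> = (\<integral>\<^sup>+y. ennreal (?h (?L y) * bracket (?L x)) \<partial>count_space UNIV)"
    by (rule nn_integral_count_space_inj[symmetric]) (auto simp: inj_on_def axis_eq_axis)
  also have "\<dots> \<le> (\<integral>\<^sup>+y. ennreal (line_kernel x y * (16 * weighted_abs f (?L y))) \<partial>count_space UNIV)"
  proof (intro nn_integral_mono ennreal_leI)
    fix y
    have Lxy: "?L x - ?L y = axis j (x - y)" "?L x = ?L y + axis j (x - y)"
      by (auto simp: vec_eq_iff axis_def)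
    define K where "K = kappa (x - y)"
    have K: "0 \<le> K" "K * \<bar>real_of_int (x - y)\<bar> \<le> 1"
      by (auto simp: K_def kappa_def)
    have y: "1 \<le> 2 * kappa y * bracket (?L y)"
    proof -
      have "\<bar>real_of_int y\<bar> \<le> bracket (?L y)"
        using component_le_bracket[of "?L y" j] m by (simp add: axis_def)
      hence "1 + \<bar>real_of_int y\<bar> \<le> 2 * bracket (?L y)" using b[of "?L y"] by linarith
      thus ?thesis by (simp add: kappa_def field_simps)
    qed
    have "K\<^sup>2 * bracket (?L x) \<le> K\<^sup>2 * (bracket (?L y) + \<bar>real_of_int (x - y)\<bar>)"
      unfolding Lxy(2) by (intro mult_left_mono bracket_add_axis_le) auto
    also have "\<dots> = K\<^sup>2 * bracket (?L y) + K * (K * \<bar>real_of_int (x - y)\<bar>)"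
      by (simp add: power2_eq_square algebra_simps)
    \<comment> \<open>First \<open>K * |x - y| \<le> 1\<close> absorbs the increment of the weight,
      then that 1 is exchanged for \<open>2 * kappa y\<close> times the weight at
      \<open>y\<close>.\<close>
    also have "\<dots> \<le> K\<^sup>2 * bracket (?L y) + K * (2 * kappa y * bracket (?L y))"
      using K y by (intro add_left_mono mult_left_mono) auto
    also have "\<dots> \<le> 2 * (line_kernel x y * bracket (?L y))"
      using b0[of "?L y"] by (simp add: line_kernel_def K_def[symmetric] algebra_simps)
    finally have *: "K\<^sup>2 * bracket (?L x) \<le> 2 * (line_kernel x y * bracket (?L y))" .
    have "?h (?L y) * bracket (?L x) \<le> norm (f (?L y)) * (8 * K\<^sup>2) * bracket (?L x)"
      unfolding norm_mult Lxy(1) K_def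
      by (intro mult_right_mono mult_left_mono norm_deriv_kernel_axis_le b0) auto
    also have "\<dots> = 8 * norm (f (?L y)) * (K\<^sup>2 * bracket (?L x))" by simp
    also have "\<dots> \<le> 8 * norm (f (?L y)) * (2 * (line_kernel x y * bracket (?L y)))"
      by (intro mult_left_mono *) auto
    also have "\<dots> = line_kernel x y * (16 * weighted_abs f (?L y))"
      by (simp add: weighted_abs_def)
    finally show "?h (?L y) * bracket (?L x) \<le> line_kernel x y * (16 * weighted_abs f (?L y))" .
  qed
  finally show ?thesis .
qed

section \<open>Strong and weak bounds on the lattice\<close>

lemma discrete_partial_bounded_infinity:
  obtains C where "\<And>f. f \<in> weighted_lp \<infinity> 1 \<Longrightarrow>
    weighted_lp_norm \<infinity> 1 (discrete_partial j f) \<le> ennreal C * weighted_lp_norm \<infinity> 1 f"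
proof -
  obtain A where A: "0 \<le> A" "\<And>x. (\<integral>\<^sup>+y. ennreal (line_kernel x y) \<partial>count_space UNIV) \<le> ennreal A"
    by (rule line_kernel_integral_bounded) blast
  show ?thesis
  proof (rule that)
    fix f :: "int ^ 'a \<Rightarrow> complex" assume f: "f \<in> weighted_lp \<infinity> 1"
    show "weighted_lp_norm \<infinity> 1 (discrete_partial j f) \<le> ennreal (A * 16) * weighted_lp_norm \<infinity> 1 f"
      unfolding weighted_lp_norm_infinity
    proof (rule SUP_least)
      fix k :: "int ^ 'a"
      define m where "m = k - axis j (k $ j)"
      let ?M = "SUP k. ennreal (weighted_abs f k)"
      have k: "k = m + axis j (k $ j)" and m: "m $ j = 0" by (auto simp: m_def vec_eq_iff axis_def)
      have "ennreal (weighted_abs (discrete_partial j f) k) \<le>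
        (\<integral>\<^sup>+y. ennreal (line_kernel (k $ j) y * (16 * weighted_abs f (m + axis j y))) \<partial>count_space UNIV)"
        using discrete_partial_line_bound[OF f _ m, of "k $ j"] k by simp
      also have "\<dots> \<le> (\<integral>\<^sup>+y. ennreal (line_kernel (k $ j) y) * (16 * ?M) \<partial>count_space UNIV)"
        by (intro nn_integral_mono)
           (auto simp: ennreal_mult line_kernel_nonneg weighted_abs_nonneg intro!: mult_left_mono SUP_upper)
      also have "\<dots> = (\<integral>\<^sup>+y. ennreal (line_kernel (k $ j) y) \<partial>count_space UNIV) * (16 * ?M)"
        by (simp add: nn_integral_multc)
      also have "\<dots> \<le> ennreal A * (16 * ?M)" by (intro mult_right_mono A) simp
      also have "\<dots> = ennreal (A * 16) * ?M" using A(1) by (simp add: ennreal_mult mult.assoc)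
      finally show "ennreal (weighted_abs (discrete_partial j f) k) \<le> ennreal (A * 16) * ?M" .
    qed
  qed
qed

lemma discrete_partial_bounded_finite:
  assumes p: "1 < p" "p \<noteq> \<infinity>"
  obtains C where "\<And>f. f \<in> weighted_lp p 1 \<Longrightarrow>
    weighted_lp_norm p 1 (discrete_partial j f) \<le> ennreal C * weighted_lp_norm p 1 f"
proof -
  define r where "r = enn2real p"
  have r: "1 < r"
  proof (cases p)
    case (real x)
    thus ?thesis using p(1) by (simp add: r_def)
  qed (use p(2) in simp)
  obtain C where C: "0 < C"
    "\<And>F G. (\<And>x. 0 \<le> F x) \<Longrightarrow> (\<And>x. 0 \<le> G x) \<Longrightarrow>
      (\<And>x. ennreal (F x) \<le> (\<integral>\<^sup>+y. ennreal (line_kernel x y * G y) \<partial>count_space UNIV)) \<Longrightarrow>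
      (\<integral>\<^sup>+x. ennreal (F x powr r) \<partial>count_space UNIV) \<le>
        ennreal C * (\<integral>\<^sup>+x. ennreal (G x powr r) \<partial>count_space UNIV)"
    by (rule line_kernel_lp_bounded[OF r]) blast
  \<comment> \<open>The factor 16 of the line bound multiplies \<open>f\<close> and is raised to the
    power \<open>r\<close> in the power sums.\<close>
  define D where "D = C * 16 powr r"
  have D: "0 < D" using C by (simp add: D_def)
  show ?thesis
  proof (rule that, rule weighted_lp_norm_le[OF p D])
    fix f :: "int ^ 'a \<Rightarrow> complex" assume f: "f \<in> weighted_lp p 1"
    show "(\<integral>\<^sup>+k. ennreal (weighted_abs (discrete_partial j f) k powr enn2real p) \<partial>count_space UNIV)
       \<le> ennreal D * (\<integral>\<^sup>+k. ennreal (weighted_abs f k powr enn2real p) \<partial>count_space UNIV)"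
      unfolding r_def[symmetric]
    proof (rule nn_integral_lines_mono)
      fix m :: "int ^ 'a" assume m: "m $ j = 0"
      have "(\<integral>\<^sup>+x. ennreal (weighted_abs (discrete_partial j f) (m + axis j x) powr r) \<partial>count_space UNIV) \<le>
        ennreal C * (\<integral>\<^sup>+x. ennreal ((16 * weighted_abs f (m + axis j x)) powr r) \<partial>count_space UNIV)"
        using p by (intro C discrete_partial_line_bound[OF f _ m]) (auto simp: weighted_abs_nonneg)
      also have "\<dots> = ennreal D * (\<integral>\<^sup>+x. ennreal (weighted_abs f (m + axis j x) powr r) \<partial>count_space UNIV)"
        using C(1) by (simp add: D_def powr_mult weighted_abs_nonneg ennreal_mult nn_integral_cmult mult.assoc)
      finally show "(\<integral>\<^sup>+x. ennreal (weighted_abs (discrete_partial j f) (m + axis j x) powr r) \<partial>count_space UNIV) \<le>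
        ennreal D * (\<integral>\<^sup>+x. ennreal (weighted_abs f (m + axis j x) powr r) \<partial>count_space UNIV)" .
    qed
  qed
qed

lemma discrete_partial_weak_bounded:
  obtains C where "\<And>f \<alpha>. f \<in> weighted_lp 1 1 \<Longrightarrow> 0 < \<alpha> \<Longrightarrow>
    ennreal \<alpha> * emeasure (count_space UNIV) {k. norm (discrete_partial j f k) \<ge> \<alpha> / bracket k}
      \<le> ennreal C * weighted_lp_norm 1 1 f"
proof -
  obtain C where C: "0 < C"
    "\<And>F G \<alpha>. 0 < \<alpha> \<Longrightarrow> (\<And>x. 0 \<le> G x) \<Longrightarrow>
      (\<And>x. ennreal (F x) \<le> (\<integral>\<^sup>+y. ennreal (line_kernel x y * G y) \<partial>count_space UNIV)) \<Longrightarrow>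
      ennreal \<alpha> * emeasure (count_space UNIV) {x. \<alpha> \<le> F x} \<le>
        ennreal C * (\<integral>\<^sup>+x. ennreal (G x) \<partial>count_space UNIV)"
    by (rule line_kernel_weak_bounded) blast
  show ?thesis
  proof (rule that)
    fix f :: "int ^ 'a \<Rightarrow> complex" and \<alpha> :: real
    assume f: "f \<in> weighted_lp 1 1" and \<alpha>: "0 < \<alpha>"
    let ?F = "weighted_abs (discrete_partial j f)"
    have set_eq: "{k. norm (discrete_partial j f k) \<ge> \<alpha> / bracket k} = {k. \<alpha> \<le> ?F k}"
    proof -
      have "0 < bracket k" for k :: "int ^ 'a" using bracket_ge_1[of k] by linarith
      thus ?thesis by (simp add: weighted_abs_def divide_le_eq)
    qed
    \<comment> \<open>Written as an integral, the left side is additive over lines. The level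
      \<open>\<alpha>\<close> is the same on all of them and the right side is an \<open>l^1\<close>
      sum, so the weak bounds on the lines add up.\<close>
    have "ennreal \<alpha> * emeasure (count_space UNIV) {k. \<alpha> \<le> ?F k} =
        (\<integral>\<^sup>+k. ennreal \<alpha> * indicator {k. \<alpha> \<le> ?F k} k \<partial>count_space UNIV)"
      by (simp add: nn_integral_cmult_indicator)
    also have "\<dots> \<le> ennreal (C * 16) * (\<integral>\<^sup>+k. ennreal (weighted_abs f k) \<partial>count_space UNIV)"
    proof (rule nn_integral_lines_mono)
      fix m :: "int ^ 'a" assume m: "m $ j = 0"
      have "(\<integral>\<^sup>+x. ennreal \<alpha> * indicator {k. \<alpha> \<le> ?F k} (m + axis j x) \<partial>count_space UNIV) =
          (\<integral>\<^sup>+x. ennreal \<alpha> * indicator {x. \<alpha> \<le> ?F (m + axis j x)} x \<partial>count_space UNIV)"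
        by (intro nn_integral_cong) (simp add: indicator_def)
      also have "\<dots> = ennreal \<alpha> * emeasure (count_space UNIV) {x. \<alpha> \<le> ?F (m + axis j x)}"
        by (rule nn_integral_cmult_indicator) simp
      also have "\<dots> \<le> ennreal C * (\<integral>\<^sup>+x. ennreal (16 * weighted_abs f (m + axis j x)) \<partial>count_space UNIV)"
        by (intro C(2) \<alpha> discrete_partial_line_bound[OF f _ m]) (auto simp: weighted_abs_nonneg)
      also have "\<dots> = ennreal (C * 16) * (\<integral>\<^sup>+x. ennreal (weighted_abs f (m + axis j x)) \<partial>count_space UNIV)"
        using C(1) by (simp add: weighted_abs_nonneg ennreal_mult nn_integral_cmult mult.assoc)
      finally show "(\<integral>\<^sup>+x. ennreal \<alpha> * indicator {k. \<alpha> \<le> ?F k} (m + axis j x) \<partial>count_space UNIV) \<le>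
          ennreal (C * 16) * (\<integral>\<^sup>+x. ennreal (weighted_abs f (m + axis j x)) \<partial>count_space UNIV)" .
    qed
    finally show "ennreal \<alpha> * emeasure (count_space UNIV) {k. norm (discrete_partial j f k) \<ge> \<alpha> / bracket k}
      \<le> ennreal (C * 16) * weighted_lp_norm 1 1 f"
      by (simp add: set_eq weighted_lp_norm_1)
  qed
qed

section \<open>Failure of the strong bound for exponent 1\<close>

lemma discrete_partial_delta: "discrete_partial j (\<lambda>m. if m = 0 then 1 else 0) = deriv_kernel j"
proof
  fix k :: "int ^ 'a"
  have "discrete_partial j (\<lambda>m. if m = 0 then 1 else 0) k =
      (\<Sum>\<^sub>\<infinity>m\<in>{0}. (if m = 0 then 1 else 0) * deriv_kernel j (k - m))"
    unfolding discrete_partial_def lattice_convolution_def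
    by (rule infsum_cong_neutral) auto
  thus "discrete_partial j (\<lambda>m. if m = 0 then 1 else 0) k = deriv_kernel j k" by simp
qed

lemma weighted_l1_norm_delta:
  "weighted_lp_norm 1 1 (\<lambda>m :: int ^ 'd::finite. if m = 0 then 1 else 0) = 1"
proof -
  have "bracket (0 :: int ^ 'd) = 1"
    by (simp add: bracket_def zero_vec_def[symmetric])
  hence "ennreal (weighted_abs (\<lambda>m :: int ^ 'd. if m = 0 then 1 else 0) k) = indicator {0} k" for k
    by (auto simp: weighted_abs_def)
  thus ?thesis by (simp add: weighted_lp_norm_1)
qed

text \<open>On the positive half-axis the kernel is at least \<open>1 / (pi * t^2)\<close> in
  modulus and the weight is at least \<open>t\<close>, so the norm dominates a multiple of the
  harmonic series.\<close>

lemma weighted_l1_norm_deriv_kernel: "weighted_lp_norm 1 1 (deriv_kernel j) = \<infinity>"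
proof (rule ccontr)
  assume fin: "weighted_lp_norm 1 1 (deriv_kernel j) \<noteq> \<infinity>"
  let ?w = "weighted_abs (deriv_kernel j)"
  \<comment> \<open>The shift by one skips the origin, so that \<open>4 * t^2 - 1\<close> is
    positive for every \<open>t = n + 1\<close>.\<close>
  let ?L = "\<lambda>n::nat. axis j (int n + 1)"
  have "(\<Sum>n. ennreal (1 / (pi * (real n + 1)))) = (\<integral>\<^sup>+n. ennreal (1 / (pi * (real n + 1))) \<partial>count_space UNIV)"
    by (rule nn_integral_count_space_nat[symmetric])
  also have "\<dots> \<le> (\<integral>\<^sup>+n. ennreal (?w (?L n)) \<partial>count_space UNIV)"
  proof (intro nn_integral_mono ennreal_leI)
    fix n :: nat
    define t where "t = real n + 1"
    have t: "1 \<le> t" by (simp add: t_def)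
    hence t2: "1 \<le> t\<^sup>2" by (rule one_le_power)
    have "1 / (pi * t) = 4 / (pi * (4 * t\<^sup>2)) * t" using t by (simp add: power2_eq_square)
    also have "\<dots> \<le> 4 / (pi * \<bar>4 * t\<^sup>2 - 1\<bar>) * t"
    proof -
      have d: "\<bar>4 * t\<^sup>2 - 1\<bar> = 4 * t\<^sup>2 - 1" "0 < 4 * t\<^sup>2 - 1" using t2 by linarith+
      show ?thesis
        unfolding d(1) using t d(2) by (intro mult_right_mono frac_le mult_left_mono mult_pos_pos) auto
    qed
    also have "\<dots> = norm (deriv_kernel j (?L n)) * t"
      unfolding norm_deriv_kernel_axis by (simp add: t_def)
    also have "\<dots> \<le> ?w (?L n)"
      using component_le_bracket[of "?L n" j]
      unfolding weighted_abs_def by (intro mult_left_mono) (auto simp: axis_def t_def)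
    finally show "1 / (pi * (real n + 1)) \<le> ?w (?L n)" by (simp add: t_def)
  qed
  also have "\<dots> = (\<integral>\<^sup>+k\<in>range ?L. ennreal (?w k) \<partial>count_space UNIV)"
    by (rule nn_integral_count_space_inj) (auto simp: inj_on_def axis_eq_axis)
  also have "\<dots> \<le> (\<integral>\<^sup>+k. ennreal (?w k) \<partial>count_space UNIV)"
    by (intro nn_integral_mono) (auto split: split_indicator)
  also have "\<dots> < \<infinity>" using fin by (simp add: weighted_lp_norm_1 top.not_eq_extremum)
  finally have "summable (\<lambda>n. 1 / (pi * (real n + 1)))"
    by (intro summable_suminf_not_top) auto
  hence "summable (\<lambda>n. pi * (1 / (pi * (real n + 1))))" by (rule summable_mult)
  also have "(\<lambda>n. pi * (1 / (pi * (real n + 1)))) = (\<lambda>n. inverse (real (Suc n)))"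
    by (rule ext) (simp add: inverse_eq_divide)
  finally have "summable (\<lambda>n. inverse (real (Suc n)))" .
  thus False using not_summable_harmonic[where 'a = real] summable_Suc_iff[of "\<lambda>n. inverse (real n)"] by simp
qed

theorem theorem2p14:
  fixes j :: "'d::finite"
  shows "(\<forall>p::ennreal. 1 < p \<longrightarrow>
            (\<exists>C::real. \<forall>f \<in> weighted_lp p 1.
               weighted_lp_norm p 1 (discrete_partial j f) \<le> ennreal C * weighted_lp_norm p 1 f)) \<and>
         \<not> (\<exists>C::real. \<forall>f \<in> weighted_lp 1 1.
               weighted_lp_norm 1 1 (discrete_partial j f) \<le> ennreal C * weighted_lp_norm 1 1 f) \<and>
         (\<exists>C::real. \<forall>f \<in> weighted_lp 1 1.
            (SUP \<alpha>\<in>{0::real<..}. ennreal \<alpha> *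
               emeasure (count_space UNIV) {k. norm (discrete_partial j f k) \<ge> \<alpha> / bracket k})
            \<le> ennreal C * weighted_lp_norm 1 1 f)"
proof (intro conjI allI impI notI)
  fix p :: ennreal assume p: "1 < p"
  show "\<exists>C::real. \<forall>f \<in> weighted_lp p 1.
     weighted_lp_norm p 1 (discrete_partial j f) \<le> ennreal C * weighted_lp_norm p 1 f"
  proof (cases "p = \<infinity>")
    case True
    show ?thesis unfolding True by (rule discrete_partial_bounded_infinity[of j]) blast
  next
    case False
    show ?thesis by (rule discrete_partial_bounded_finite[OF p False, of j]) blast
  qed
next
  let ?\<delta> = "\<lambda>m :: int ^ 'd. if m = 0 then 1 else 0 :: complex"
  assume "\<exists>C::real. \<forall>f \<in> weighted_lp 1 1.
     weighted_lp_norm 1 1 (discrete_partial j f) \<le> ennreal C * weighted_lp_norm 1 1 f"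
  then obtain C where C: "\<And>f. f \<in> weighted_lp 1 1 \<Longrightarrow>
     weighted_lp_norm 1 1 (discrete_partial j f) \<le> ennreal C * weighted_lp_norm 1 1 f" by blast
  have "?\<delta> \<in> weighted_lp 1 1" by (simp add: weighted_lp_def weighted_l1_norm_delta)
  \<comment> \<open>The image of the unit mass has infinite norm, while \<open>ennreal C * 1\<close>
    is finite for every real \<open>C\<close>, negative ones included.\<close>
  from C[OF this] show False
    by (simp add: discrete_partial_delta weighted_l1_norm_delta weighted_l1_norm_deriv_kernel top_unique)
next
  show "\<exists>C::real. \<forall>f \<in> weighted_lp 1 1.
      (SUP \<alpha>\<in>{0::real<..}. ennreal \<alpha> *
         emeasure (count_space UNIV) {k. norm (discrete_partial j f k) \<ge> \<alpha> / bracket k})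
      \<le> ennreal C * weighted_lp_norm 1 1 f"
  proof -
    obtain C where C: "\<And>f \<alpha>. f \<in> weighted_lp 1 1 \<Longrightarrow> 0 < \<alpha> \<Longrightarrow>
      ennreal \<alpha> * emeasure (count_space UNIV) {k. norm (discrete_partial j f k) \<ge> \<alpha> / bracket k}
        \<le> ennreal C * weighted_lp_norm 1 1 f"
      by (rule discrete_partial_weak_bounded[of j]) blast
    show ?thesis by (intro exI[of _ C] ballI SUP_least C) auto
  qed
qed

end
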